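(* Let $d\ge 2$, let $p_k,q_k\in\mathbb{R}$ for $0\le k\le d-1$, and let $(a_n)_{n\ge 0}$ be a real sequence satisfying $a_{n+1}=\sum_{k=0}^{d-1}(p_k n+q_k)\,a_{n-k}$ for all $n\ge d-1$. Let $\mathbf{v}_n$, $A$, $B$ and $M_n=nA+B$ be the associated state vectors and companion matrices. Then for all $n\ge d-1$, $$b_n:=a_n^2-a_{n+1}a_{n-1}=\mathbf{v}_n^\top Q_n\mathbf{v}_n,$$ where $Q_n$ is the symmetric $d\times d$ matrix $$Q_n=e_1e_1^\top-\tfrac12\bigl(M_n^\top e_1e_2^\top+e_2e_1^\top M_n\bigr).$$ Moreover $Q_n$ decomposes as $Q_n=Q^{(0)}+n\,Q^{(1)}$, where $$Q^{(0)}=e_1e_1^\top-\tfrac12\bigl(B^\top e_1e_2^\top+e_2e_1^\top B\bigr),\qquad Q^{(1)}=-\tfrac12\bigl(A^\top e_1e_2^\top+e_2e_1^\top A\bigr).$$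
   Context: $e_1,e_2$ are the first two standard basis vectors of $\mathbb{R}^d$. For $n\ge d-1$ the state vector is $\mathbf{v}_n=(a_n,a_{n-1},\ldots,a_{n-d+1})^\top\in\mathbb{R}^d$. The $d\times d$ matrix $A$ has first row $(p_0,p_1,\ldots,p_{d-1})$ and all other entries $0$. The $d\times d$ matrix $B$ has first row $(q_0,q_1,\ldots,q_{d-1})$, entries $1$ in positions $(i+1,i)$ for $1\le i\le d-1$, and all other entries $0$. The companion matrix is $M_n=nA+B$, so that $\mathbf{v}_{n+1}=M_n\mathbf{v}_n$ for $n\ge d-1$. *)

theory Defs
  imports Complex_Main "Jordan_Normal_Form.Matrix"
begin

(* Vectors and matrices are indexed from 0: the mathematical position (i, j) is
   index (i - 1, j - 1) here, and e_1, e_2 are unit_vec d 0, unit_vec d 1. *)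

definition outer_prod :: "real vec \<Rightarrow> real vec \<Rightarrow> real mat" where
  "outer_prod x y = mat (dim_vec x) (dim_vec y) (\<lambda>(i, j). x $ i * y $ j)"

abbreviation e1 :: "nat \<Rightarrow> real vec" where "e1 d \<equiv> unit_vec d 0"
abbreviation e2 :: "nat \<Rightarrow> real vec" where "e2 d \<equiv> unit_vec d 1"

(* (a_n, a_{n-1}, ..., a_{n-d+1}); meaningful for n \<ge> d - 1, where n - i does not truncate. *)
definition state_vec :: "nat \<Rightarrow> (nat \<Rightarrow> real) \<Rightarrow> nat \<Rightarrow> real vec" where
  "state_vec d a n = vec d (\<lambda>i. a (n - i))"

definition A_mat :: "nat \<Rightarrow> (nat \<Rightarrow> real) \<Rightarrow> real mat" where
  "A_mat d p = mat d d (\<lambda>(i, j). if i = 0 then p j else 0)"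

definition B_mat :: "nat \<Rightarrow> (nat \<Rightarrow> real) \<Rightarrow> real mat" where
  "B_mat d q = mat d d (\<lambda>(i, j). if i = 0 then q j else if i = j + 1 then 1 else 0)"

definition M_mat :: "nat \<Rightarrow> (nat \<Rightarrow> real) \<Rightarrow> (nat \<Rightarrow> real) \<Rightarrow> nat \<Rightarrow> real mat" where
  "M_mat d p q n = real n \<cdot>\<^sub>m A_mat d p + B_mat d q"

definition Q_mat :: "nat \<Rightarrow> (nat \<Rightarrow> real) \<Rightarrow> (nat \<Rightarrow> real) \<Rightarrow> nat \<Rightarrow> real mat" where
  "Q_mat d p q n = outer_prod (e1 d) (e1 d)
     - (1/2) \<cdot>\<^sub>m (transpose_mat (M_mat d p q n) * outer_prod (e1 d) (e2 d)
                  + outer_prod (e2 d) (e1 d) * M_mat d p q n)"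

definition Q0_mat :: "nat \<Rightarrow> (nat \<Rightarrow> real) \<Rightarrow> real mat" where
  "Q0_mat d q = outer_prod (e1 d) (e1 d)
     - (1/2) \<cdot>\<^sub>m (transpose_mat (B_mat d q) * outer_prod (e1 d) (e2 d)
                  + outer_prod (e2 d) (e1 d) * B_mat d q)"

definition Q1_mat :: "nat \<Rightarrow> (nat \<Rightarrow> real) \<Rightarrow> real mat" where
  "Q1_mat d p = - ((1/2) \<cdot>\<^sub>m (transpose_mat (A_mat d p) * outer_prod (e1 d) (e2 d)
                  + outer_prod (e2 d) (e1 d) * A_mat d p))"

end

theory Submission
  imports Defs
begin

text \<open>Write v for the state vector at n. Its coordinates 0 and 1 are \<open>a n\<close> and
  \<open>a (n - 1)\<close>, and the recurrence says that \<open>a (n + 1)\<close> is coordinate 0 of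
  M_n v. So b_n is the square of the linear form e_1^T v minus the product of the linear forms e_1^T
  M_n v and e_2^T v; symmetrizing the matrix of that product gives Q_n. Since M_n is affine in n, so
  is Q_n. The entries of Q_n are made explicit in \<open>Q_mat_eq\<close>, from which symmetry, the
  decomposition (\<open>Q_mat_decomp\<close>) and the quadratic form
  (\<open>quadratic_form_Q_mat\<close>) are read off.\<close>

lemma M_mat_carrier [simp]: "M_mat d p q n \<in> carrier_mat d d"
  by (simp add: M_mat_def A_mat_def B_mat_def)

text \<open>X^T e_k is row k of X, and multiplying on the right by e_l^T places it in column l. The
  next lemma is the transposed version.\<close>

lemma transpose_mult_outer_prod_units:
  assumes "X \<in> carrier_mat d d" "k < d" "l < d"
  shows "transpose_mat X * outer_prod (unit_vec d k) (unit_vec d l)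
    = mat d d (\<lambda>(i, j). if j = l then X $$ (k, i) else 0)"
  using assms
  by (intro eq_matI)
    (auto simp: outer_prod_def scalar_prod_def if_distrib[of "(*) x" for x]
      if_distrib[of "\<lambda>y. y * x" for x] cong: if_cong)

lemma outer_prod_units_mult:
  assumes "X \<in> carrier_mat d d" "k < d" "l < d"
  shows "outer_prod (unit_vec d l) (unit_vec d k) * X
    = mat d d (\<lambda>(i, j). if i = l then X $$ (k, j) else 0)"
  using assms
  by (intro eq_matI)
    (auto simp: outer_prod_def scalar_prod_def if_distrib[of "(*) x" for x]
      if_distrib[of "\<lambda>y. y * x" for x] cong: if_cong)

lemma outer_prod_units:
  assumes "k < d" "l < d"
  shows "outer_prod (unit_vec d k) (unit_vec d l)
    = mat d d (\<lambda>(i, j). if i = k \<and> j = l then 1 else 0)"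
  using assms by (intro eq_matI) (auto simp: outer_prod_def)

text \<open>Only the top row of M_n survives the products with the unit vectors: half of it is
  subtracted from column 1 and half from row 1.\<close>

lemma Q_mat_eq:
  assumes "d \<ge> 2"
  shows "Q_mat d p q n = mat d d (\<lambda>(i, j). (if i = 0 \<and> j = 0 then 1 else 0)
    - ((if j = 1 then M_mat d p q n $$ (0, i) else 0)
       + (if i = 1 then M_mat d p q n $$ (0, j) else 0)) / 2)"
proof -
  have "0 < d" "1 < d" using assms by auto
  then show ?thesis
    unfolding Q_mat_def outer_prod_units[OF \<open>0 < d\<close> \<open>0 < d\<close>]
      transpose_mult_outer_prod_units[OF M_mat_carrier \<open>0 < d\<close> \<open>1 < d\<close>]
      outer_prod_units_mult[OF M_mat_carrier \<open>0 < d\<close> \<open>1 < d\<close>]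
    by (intro eq_matI) auto
qed

text \<open>Each entry is affine in the top row of M_n = nA + B; the constant e_1 e_1^T goes into
  the part free of n.\<close>

lemma Q_mat_decomp:
  assumes "d \<ge> 2"
  shows "Q_mat d p q n = Q0_mat d q + real n \<cdot>\<^sub>m Q1_mat d p"
proof -
  have A: "A_mat d p \<in> carrier_mat d d" and B: "B_mat d q \<in> carrier_mat d d"
    by (simp_all add: A_mat_def B_mat_def)
  have "0 < d" "1 < d" using assms by auto
  then show ?thesis
    unfolding Q_mat_eq[OF assms] Q0_mat_def Q1_mat_def
      outer_prod_units[OF \<open>0 < d\<close> \<open>0 < d\<close>]
      transpose_mult_outer_prod_units[OF A \<open>0 < d\<close> \<open>1 < d\<close>]
      transpose_mult_outer_prod_units[OF B \<open>0 < d\<close> \<open>1 < d\<close>]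
      outer_prod_units_mult[OF A \<open>0 < d\<close> \<open>1 < d\<close>]
      outer_prod_units_mult[OF B \<open>0 < d\<close> \<open>1 < d\<close>]
    using A B
    by (intro eq_matI) (auto simp: M_mat_def algebra_simps add_divide_distrib)
qed

text \<open>Row 1 and column 1 of the matrix each contribute half of the product of (M_n x)_0 and
  \<open>x $ 1\<close>.\<close>

lemma quadratic_form_Q_mat:
  assumes "d \<ge> 2" "x \<in> carrier_vec d"
  shows "x \<bullet> (Q_mat d p q n *\<^sub>v x)
    = (x $ 0)\<^sup>2 - (\<Sum>j<d. M_mat d p q n $$ (0, j) * x $ j) * x $ 1"
proof -
  define m where "m j = M_mat d p q n $$ (0, j)" for j
  \<comment> \<open>\<open>S\<close> is coordinate 0 of M_n x.\<close>
  define S where "S = (\<Sum>j<d. m j * x $ j)"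
  have "x \<bullet> (Q_mat d p q n *\<^sub>v x) = (\<Sum>i<d. x $ i * (\<Sum>j<d.
      ((if i = 0 \<and> j = 0 then 1 else 0)
       - ((if j = 1 then m i else 0) + (if i = 1 then m j else 0)) / 2) * x $ j))"
    using assms unfolding m_def by (simp add: Q_mat_eq scalar_prod_def lessThan_atLeast0)
  also have "\<dots> = (\<Sum>i<d. x $ i *
      ((if i = 0 then x $ 0 else 0) - (m i * x $ 1 + (if i = 1 then S else 0)) / 2))"
  proof (rule sum.cong[OF refl])
    fix i
    \<comment> \<open>Moving \<open>x $ j\<close> inside the conditionals lets the sums over j with
      a condition on j collapse to one term; the row-1 part becomes \<open>S\<close>.\<close>
    have "(\<Sum>j<d. ((if i = 0 \<and> j = 0 then 1 else 0)
        - ((if j = 1 then m i else 0) + (if i = 1 then m j else 0)) / 2) * x $ j)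
      = (\<Sum>j<d. (if j = 0 then if i = 0 then x $ 0 else 0 else 0)
        - ((if j = 1 then m i * x $ 1 else 0) + (if i = 1 then m j * x $ j else 0)) / 2)"
      by (rule sum.cong) (auto simp: field_simps)
    also have "\<dots> = (if i = 0 then x $ 0 else 0)
        - (m i * x $ 1 + (if i = 1 then S else 0)) / 2"
      using assms
      by (simp add: S_def sum_subtractf sum.distrib flip: sum_divide_distrib)
    finally show "x $ i * (\<Sum>j<d. ((if i = 0 \<and> j = 0 then 1 else 0)
        - ((if j = 1 then m i else 0) + (if i = 1 then m j else 0)) / 2) * x $ j)
      = x $ i * ((if i = 0 then x $ 0 else 0)
        - (m i * x $ 1 + (if i = 1 then S else 0)) / 2)" by simp
  qed
  \<comment> \<open>Now the column-1 part also sums to \<open>S * x $ 1\<close>, so the two halves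
    add up to a whole.\<close>
  also have "\<dots> = (\<Sum>i<d. (if i = 0 then (x $ 0)\<^sup>2 else 0)
      - (m i * x $ i * x $ 1 + (if i = 1 then S * x $ 1 else 0)) / 2)"
    by (rule sum.cong) (auto simp: field_simps power2_eq_square)
  also have "\<dots> = (x $ 0)\<^sup>2 - S * x $ 1"
    using assms
    by (simp add: S_def sum_subtractf sum.distrib flip: sum_divide_distrib sum_distrib_right)
  finally show ?thesis by (simp add: S_def m_def)
qed

theorem lemma3p1:
  fixes d :: nat and p q :: "nat \<Rightarrow> real" and a :: "nat \<Rightarrow> real"
  assumes "d \<ge> 2"
    and "\<forall>n\<ge>d - 1. a (n + 1) = (\<Sum>k=0..d - 1. (p k * real n + q k) * a (n - k))"
  shows "\<forall>n\<ge>d - 1.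
      (a n)\<^sup>2 - a (n + 1) * a (n - 1) = state_vec d a n \<bullet> (Q_mat d p q n *\<^sub>v state_vec d a n)
    \<and> Q_mat d p q n \<in> carrier_mat d d
    \<and> transpose_mat (Q_mat d p q n) = Q_mat d p q n
    \<and> Q_mat d p q n = Q0_mat d q + real n \<cdot>\<^sub>m Q1_mat d p"
proof (intro allI impI conjI)
  fix n
  assume "n \<ge> d - 1"
  have "{0..d - 1} = {..<d}"
    using assms(1) by auto
  then have "a (n + 1) = (\<Sum>k<d. (p k * real n + q k) * a (n - k))"
    using assms(2) \<open>n \<ge> d - 1\<close> by simp
  \<comment> \<open>The coefficients of the recurrence are exactly the top row of M_n.\<close>
  also have "\<dots> = (\<Sum>j<d. M_mat d p q n $$ (0, j) * state_vec d a n $ j)"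
    by (rule sum.cong) (auto simp: M_mat_def A_mat_def B_mat_def state_vec_def)
  finally show "(a n)\<^sup>2 - a (n + 1) * a (n - 1)
      = state_vec d a n \<bullet> (Q_mat d p q n *\<^sub>v state_vec d a n)"
    using assms(1) by (subst quadratic_form_Q_mat) (auto simp: state_vec_def)
  show "Q_mat d p q n \<in> carrier_mat d d"
    using assms(1) by (simp add: Q_mat_eq)
  \<comment> \<open>Swapping i and j exchanges the row-1 and column-1 terms of the entry
    formula.\<close>
  show "transpose_mat (Q_mat d p q n) = Q_mat d p q n"
    using assms(1) by (intro eq_matI) (auto simp: Q_mat_eq)
  show "Q_mat d p q n = Q0_mat d q + real n \<cdot>\<^sub>m Q1_mat d p"
    using assms(1) by (rule Q_mat_decomp)
qed

end
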